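(* Let $\alpha>0$ and $\beta\in\mathbb{R}$. Let $(\omega_k)_{k\ge1}$ be positive reals with $\omega_k$ scaling as $k^\alpha$, i.e. $\lim_{k\to\infty}\omega_k/k^\alpha=\omega_0$ for some $\omega_0\in(0,\infty)$, and let $(\gamma_k)_{k\ge1}$ be reals with $\gamma_k$ scaling as $k^\beta$, i.e. $\lim_{k\to\infty}|\gamma_k|/k^\beta=\gamma_0$ for some $\gamma_0\in(0,\infty)$. Let $$S_X(\omega)=\sum_{k=1}^{\infty}\gamma_k^2\,\frac{\omega_k}{\omega_k^2+\omega^2}.$$ If $\alpha>|2\beta+1|$, then $S_X(\omega)$ scales as $\omega^\zeta$ with $$\zeta=\frac{2\beta-\alpha+1}{\alpha},$$ i.e. there is a constant $C\in(0,\infty)$ such that $\lim_{\omega\to\infty}S_X(\omega)/\omega^\zeta=C$. Moreover $-2<\zeta<0$. In particular $\zeta=-1$ (exact $1/f$ noise) when $\beta=-1/2$, for any $\alpha>0$.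
   Context: The function $S_X$ is the power spectral density of a reversible continuous time Markov chain, written as a superposition of Lorentzians, where $\omega_k$ are the non-zero eigenvalues of the infinitesimal generator $\mathbf{G}$ and $\gamma_k$ are the coupling strengths of the eigenvectors to the state vector $\mathbf{x}$ ($\gamma_k^2=\langle\mathbf{x},\boldsymbol{\Pi}_k\mathbf{x}\rangle_{\boldsymbol{\pi}}$, with $\boldsymbol{\Pi}_k$ the spectral projector for $\omega_k$ and $\langle\mathbf{u},\mathbf{v}\rangle_{\boldsymbol{\pi}}=\sum_i\pi_iu_iv_i$, $\boldsymbol{\pi}$ the stationary distribution). The power laws are assumed for an infinite sequence of eigenvalues, and the claim concerns the resulting infinite sum. "Scales as" means asymptotic to a positive constant multiple of the power law at infinity. *)

theory Defs
  imports Complex_Main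
begin

definition lorentzian :: "real \<Rightarrow> real \<Rightarrow> real" where
  "lorentzian a \<omega> = a / (a\<^sup>2 + \<omega>\<^sup>2)"

(* Sequences are indexed from 1 as in the formula for S_X: the values at index 0 are never used,
   and the k-th summand (k counted from 0) belongs to eigenvalue number Suc k. *)
definition psd_term :: "(nat \<Rightarrow> real) \<Rightarrow> (nat \<Rightarrow> real) \<Rightarrow> real \<Rightarrow> nat \<Rightarrow> real" where
  "psd_term \<gamma> w \<omega> k = (\<gamma> (Suc k))\<^sup>2 * lorentzian (w (Suc k)) \<omega>"

definition psd :: "(nat \<Rightarrow> real) \<Rightarrow> (nat \<Rightarrow> real) \<Rightarrow> real \<Rightarrow> real" where
  "psd \<gamma> w \<omega> = (\<Sum>k. psd_term \<gamma> w \<omega> k)"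

definition scales_as :: "(real \<Rightarrow> real) \<Rightarrow> real \<Rightarrow> bool" where
  "scales_as f \<zeta> \<longleftrightarrow> (\<exists>C>0. ((\<lambda>\<omega>. f \<omega> / \<omega> powr \<zeta>) \<longlongrightarrow> C) at_top)"

end

theory Submission
  imports Defs "HOL-Analysis.Analysis" "HOL-Real_Asymp.Multiseries_Expansion"
begin

text \<open>
  Why the theorem is true: put \<open>N = \<omega> powr (1 / \<alpha>)\<close>, so that \<open>\<omega> = N powr \<alpha>\<close>. If both
  sequences were exact power laws, the \<open>n\<close>-th summand would be \<open>N powr (2 * \<beta> - \<alpha>)\<close> times
  \<open>g (n / N)\<close>, where
    \<open>g t = \<gamma>\<^sub>0\<^sup>2 * t powr (2 * \<beta>) * (\<omega>\<^sub>0 * t powr \<alpha> / (\<omega>\<^sub>0\<^sup>2 * t powr (2 * \<alpha>) + 1))\<close>.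
  The whole sum is then \<open>N powr (2 * \<beta> - \<alpha> + 1) = \<omega> powr \<zeta>\<close> times a Riemann sum of \<open>g\<close> with
  mesh \<open>1 / N\<close>, and the constant is \<open>C = \<integral>\<^sub>0\<^sup>\<infinity> g\<close>. Since \<open>g\<close> behaves like
  \<open>t powr (2 * \<beta> + \<alpha>)\<close> at 0 and like \<open>t powr (2 * \<beta> - \<alpha>)\<close> at infinity, it is integrable at
  both ends exactly when \<open>\<alpha> > \<bar>2 * \<beta> + 1\<bar>\<close>.

  For merely asymptotic power laws the Riemann sum is read as the integral of a step function
  (\<open>integral_step_function\<close>). Each fixed \<open>t > 0\<close> corresponds to indices of order \<open>t * N\<close>, which
  tend to infinity with \<open>N\<close>, so the step functions converge pointwise to \<open>g\<close>; and the quotients of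
  the sequences by their power laws are bounded, so a multiple of
  \<open>min (t powr p) (t powr q)\<close>, where \<open>p = min (2 * \<beta> + \<alpha>) 0 > -1\<close> and
  \<open>q = 2 * \<beta> - \<alpha> < -1\<close>, dominates all of them. Dominated convergence
  (\<open>dominated_riemann_sums\<close>) concludes; \<open>psd_power_law\<close> assembles the pieces.
\<close>

section \<open>Riemann sums over the half-line\<close>

lemma integral_step_function:
  fixes f :: "nat \<Rightarrow> real"
  assumes N: "N > 0" and f: "summable (\<lambda>k. \<bar>f k\<bar>)"
  shows "(LINT t:{0<..}|lborel. f (nat \<lfloor>t * N\<rfloor>)) = (\<Sum>k. f k) / N"
proof -
  define I where "I k = {real k / N ..< real (Suc k) / N}" for k
  have I: "measure lborel (I k) = 1 / N" "emeasure lborel (I k) < \<infinity>" "I k \<in> sets lborel" for k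
    using N by (simp_all add: I_def field_simps)
  have mem: "t \<in> I k \<longleftrightarrow> k = nat \<lfloor>t * N\<rfloor>" if "t > 0" for t k
  proof -
    have "t \<in> I k \<longleftrightarrow> \<lfloor>t * N\<rfloor> = int k"
      using N by (simp add: I_def floor_eq_iff field_simps)
    also have "\<dots> \<longleftrightarrow> k = nat \<lfloor>t * N\<rfloor>"
      using that N by auto
    finally show ?thesis .
  qed
  have step: "(\<lambda>k. f k * indicat_real (I k) t) sums f (nat \<lfloor>t * N\<rfloor>)" if "t > 0" for t
  proof -
    have "(\<lambda>k. f k * indicat_real (I k) t) = (\<lambda>k. if k = nat \<lfloor>t * N\<rfloor> then f k else 0)"
      using mem[OF that] by (auto simp: indicator_def)
    then show ?thesis by (simp add: sums_single)
  qed
  define g where "g k t = f k * indicat_real (I k \<inter> {0<..}) t" for k t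
  have meas: "measure lborel (I k \<inter> {0<..}) = 1 / N" for k
  proof (cases "k = 0")
    case True
    then have "I k \<inter> {0<..} = {0<..<1/N}" by (auto simp: I_def)
    then show ?thesis using N by simp
  next
    case False
    then have "I k \<inter> {0<..} = I k" using N
      by (auto simp: I_def intro: less_le_trans[of 0 "real k / N"])
    then show ?thesis using I by simp
  qed
  have fin: "emeasure lborel (I k \<inter> {0<..}) < \<infinity>" for k
    by (rule le_less_trans[OF emeasure_mono I(2)[of k]]) (use I in auto)
  have int: "integrable lborel (g k)" for k
    unfolding g_def using fin I by (intro integrable_mult_right) (auto simp: integrable_indicator_iff)
  have gsums: "(\<lambda>k. g k t) sums (indicator {0<..} t * f (nat \<lfloor>t * N\<rfloor>))" for t
    using step[of t] by (cases "t > 0") (auto simp: g_def indicator_inter_arith)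
  have absg: "norm (g k t) = \<bar>f k\<bar> * indicat_real (I k \<inter> {0<..}) t" for k t
    by (simp add: g_def abs_mult)
  have "(\<lambda>k. integral\<^sup>L lborel (g k)) sums (\<integral>t. (\<Sum>k. g k t) \<partial>lborel)"
  proof (rule sums_integral[OF int])
    show "AE t in lborel. summable (\<lambda>k. norm (g k t))"
    proof (rule AE_I2)
      fix t :: real
      show "summable (\<lambda>k. norm (g k t))"
      proof (rule summable_finite[of "{nat \<lfloor>t * N\<rfloor>}"])
        show "norm (g k t) = 0" if "k \<notin> {nat \<lfloor>t * N\<rfloor>}" for k
          using that mem[of t k] by (auto simp: g_def indicator_def)
      qed simp
    qed
    show "summable (\<lambda>k. \<integral>t. norm (g k t) \<partial>lborel)"
      unfolding absg using f meas by (simp add: summable_divide)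
  qed
  moreover have "(\<Sum>k. g k t) = indicator {0<..} t * f (nat \<lfloor>t * N\<rfloor>)" for t
    using sums_unique[OF gsums] by simp
  moreover have "integral\<^sup>L lborel (g k) = f k / N" for k
    unfolding g_def using meas by simp
  ultimately have "(\<lambda>k. f k / N) sums (LINT t:{0<..}|lborel. f (nat \<lfloor>t * N\<rfloor>))"
    by (simp add: set_lebesgue_integral_def)
  moreover have "(\<Sum>k. f k / N) = (\<Sum>k. f k) / N"
    using summable_rabs_cancel[OF f] by (rule suminf_divide)
  ultimately show ?thesis by (simp add: sums_iff)
qed

text \<open>
  The domination is required only at the right end point \<open>Suc k / N\<close> of the cell of \<open>k\<close>:
  since the majorant \<open>h\<close> decreases, its value there is below its values on the whole cell. Evaluating
  at right end points keeps clear of a singularity of \<open>h\<close> at 0.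
\<close>
lemma dominated_riemann_sums:
  fixes F :: "real \<Rightarrow> nat \<Rightarrow> real" and g h :: "real \<Rightarrow> real"
  assumes summ: "\<And>N. N > 0 \<Longrightarrow> summable (\<lambda>k. \<bar>F N k\<bar>)"
    and lim: "\<And>t. t > 0 \<Longrightarrow> ((\<lambda>N. F N (nat \<lfloor>t * N\<rfloor>)) \<longlongrightarrow> g t) at_top"
    and g: "g \<in> borel_measurable borel"
    and bound: "\<And>N k. N > 0 \<Longrightarrow> \<bar>F N k\<bar> \<le> h (real (Suc k) / N)"
    and anti: "\<And>s t. 0 < t \<Longrightarrow> t \<le> s \<Longrightarrow> h s \<le> h t"
    and h: "set_integrable lborel {0<..} h"
  shows "((\<lambda>N. (\<Sum>k. F N k) / N) \<longlongrightarrow> (LINT t:{0<..}|lborel. g t)) at_top"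
    and "set_integrable lborel {0<..} g"
proof -
  define s where "s N t = indicat_real {0<..} t * F N (nat \<lfloor>t * N\<rfloor>)" for N t
  have dom: "\<bar>F N (nat \<lfloor>t * N\<rfloor>)\<bar> \<le> h t" if "N > 0" "t > 0" for N t
  proof -
    have "t * N \<le> real (Suc (nat \<lfloor>t * N\<rfloor>))" using that by simp linarith
    then have "t \<le> real (Suc (nat \<lfloor>t * N\<rfloor>)) / N" using that by (simp add: field_simps)
    then show ?thesis using bound[OF that(1)] anti[OF that(2)] order_trans by blast
  qed
  have mg: "(\<lambda>t. indicat_real {0<..} t * g t) \<in> borel_measurable lborel"
    using g by measurable
  have ms: "s N \<in> borel_measurable lborel" for N
    unfolding s_def by measurable
  have lm: "AE t in lborel. ((\<lambda>N. s N t) \<longlongrightarrow> indicat_real {0<..} t * g t) at_top"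
    by (rule AE_I2) (use lim in \<open>auto simp: s_def indicator_def\<close>)
  have bd: "\<forall>\<^sub>F N in at_top. AE t in lborel. norm (s N t) \<le> indicat_real {0<..} t * h t"
    using eventually_gt_at_top[of 0]
    by eventually_elim (auto simp: s_def indicator_def intro!: AE_I2 dom)
  have h': "integrable lborel (\<lambda>t. indicat_real {0<..} t * h t)"
    using h by (simp add: set_integrable_def)
  have "((\<lambda>N. integral\<^sup>L lborel (s N)) \<longlongrightarrow> (\<integral>t. indicat_real {0<..} t * g t \<partial>lborel)) at_top"
    by (rule integral_dominated_convergence_at_top[OF mg ms h' lm bd])
  then have L: "((\<lambda>N. integral\<^sup>L lborel (s N)) \<longlongrightarrow> (LINT t:{0<..}|lborel. g t)) at_top"
    by (simp add: set_lebesgue_integral_def)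
  have ev: "\<forall>\<^sub>F N in at_top. integral\<^sup>L lborel (s N) = (\<Sum>k. F N k) / N"
    using eventually_gt_at_top[of 0]
  proof eventually_elim
    case (elim N)
    show ?case using integral_step_function[OF elim summ[OF elim]]
      by (simp add: s_def [abs_def] set_lebesgue_integral_def)
  qed
  show "((\<lambda>N. (\<Sum>k. F N k) / N) \<longlongrightarrow> (LINT t:{0<..}|lborel. g t)) at_top"
    using tendsto_cong[OF ev] L by simp
  show "set_integrable lborel {0<..} g"
    using integrable_dominated_convergence_at_top[OF mg ms h' lm bd]
    by (simp add: set_integrable_def)
qed

lemma set_integrable_min_powr:
  fixes p q :: real
  assumes "-1 < p" "q < -1"
  shows "set_integrable lborel {0<..} (\<lambda>t. min (t powr p) (t powr q))"
proof -
  have "(\<lambda>t. t powr p) integrable_on {0..1}"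
    using has_integral_powr_from_0[of p 1] assms by (auto simp: integrable_on_def)
  then have "(\<lambda>t. t powr p) absolutely_integrable_on {0..1}"
    by (subst absolutely_integrable_on_iff_nonneg) auto
  then have 1: "set_integrable lborel {0..1} (\<lambda>t. t powr p)"
    unfolding set_integrable_def by (subst (asm) integrable_completion) auto
  have "(\<lambda>t. t powr q) integrable_on {1..}"
    using has_integral_powr_to_inf[of q 1] assms by (auto simp: integrable_on_def)
  then have "(\<lambda>t. t powr q) absolutely_integrable_on {1..}"
    by (subst absolutely_integrable_on_iff_nonneg) auto
  then have 2: "set_integrable lborel {1..} (\<lambda>t. t powr q)"
    unfolding set_integrable_def by (subst (asm) integrable_completion) auto
  have "integrable lborel (\<lambda>t. indicat_real {0..1} t * t powr p + indicat_real {1..} t * t powr q)"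
    using 1 2 by (simp add: set_integrable_def)
  then show ?thesis
    unfolding set_integrable_def
    by (rule Bochner_Integration.integrable_bound) (auto simp: indicator_def)
qed

text \<open>This makes the limit constant of the Riemann sums strictly positive.\<close>
lemma set_integral_pos:
  fixes g :: "real \<Rightarrow> real"
  assumes "set_integrable lborel {0<..} g" and "\<And>t. t > 0 \<Longrightarrow> g t > 0"
  shows "(LINT t:{0<..}|lborel. g t) > 0"
proof -
  let ?f = "\<lambda>t. indicat_real {0<..} t * g t"
  have int: "integrable lborel ?f"
    using assms(1) by (simp add: set_integrable_def)
  have nonneg: "AE t in lborel. 0 \<le> ?f t"
    by (rule AE_I2) (auto simp: indicator_def intro: less_imp_le assms(2))
  have "integral\<^sup>L lborel ?f \<noteq> 0"
  proof
    assume "integral\<^sup>L lborel ?f = 0"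
    then have "AE t in lborel. ?f t = 0"
      using integral_nonneg_eq_0_iff_AE[OF int nonneg] by simp
    then have "AE t in lborel. t \<notin> {0::real<..}"
      by eventually_elim (use assms(2) in \<open>force simp: indicator_def split: if_splits\<close>)
    \<comment> \<open>A bounded piece, whose measure the simplifier can compute.\<close>
    then have "AE t in lborel. t \<notin> {0::real<..1}"
      by eventually_elim auto
    then have "{0::real<..1} \<in> null_sets lborel"
      by (subst AE_iff_null_sets) auto
    then show False by (auto simp: null_sets_def)
  qed
  moreover have "integral\<^sup>L lborel ?f \<ge> 0"
    by (rule integral_nonneg_AE[OF nonneg])
  ultimately show ?thesis by (simp add: set_lebesgue_integral_def)
qed

section \<open>Rescaling the spectral density\<close>

lemma lorentzian_le_inverse: "a > 0 \<Longrightarrow> lorentzian a \<omega> \<le> 1 / a"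
  using frac_le[of a a "a\<^sup>2" "a\<^sup>2 + \<omega>\<^sup>2"] by (simp add: lorentzian_def power2_eq_square)

lemma lorentzian_1_le: "a > 0 \<Longrightarrow> lorentzian a 1 \<le> a"
  by (simp add: lorentzian_def divide_le_eq add_pos_pos mult_le_cancel_left1 field_simps)

lemma lorentzian_pos: "a > 0 \<Longrightarrow> lorentzian a \<omega> > 0"
  by (simp add: lorentzian_def add_pos_nonneg)

text \<open>
  With \<open>s = n / N\<close>, factoring the power laws out of \<open>\<gamma>\<close> and \<open>w\<close> leaves an expression that depends
  on \<open>N\<close> only through \<open>s\<close>, apart from the two quotients, which converge when both
  sequences scale as power laws. Both the pointwise limit
  and the domination are read off from this form.
\<close>
lemma psd_term_rescale:
  assumes "N > 0"
  shows "N powr (\<alpha> - 2 * \<beta>) * psd_term \<gamma> w (N powr \<alpha>) k =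
    (\<bar>\<gamma> (Suc k)\<bar> / real (Suc k) powr \<beta>)\<^sup>2 * ((real (Suc k) / N) powr \<beta>)\<^sup>2 *
    lorentzian (w (Suc k) / real (Suc k) powr \<alpha> * (real (Suc k) / N) powr \<alpha>) 1"
proof -
  define x y X Y where "x = real (Suc k) powr \<beta>" "y = real (Suc k) powr \<alpha>"
    "X = N powr \<beta>" "Y = N powr \<alpha>"
  have pos: "x > 0" "y > 0" "X > 0" "Y > 0"
    using assms by (simp_all add: x_y_X_Y_def)
  have 1: "N powr (\<alpha> - 2 * \<beta>) = Y / X\<^sup>2"
    using assms by (simp add: x_y_X_Y_def powr_diff power2_eq_square flip: powr_add)
  have 2: "(real (Suc k) / N) powr \<beta> = x / X" "(real (Suc k) / N) powr \<alpha> = y / Y"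
    using assms by (simp_all add: x_y_X_Y_def powr_divide)
  have 3: "lorentzian (b / y * (y / Y)) 1 = Y * lorentzian b Y" for b
  proof -
    have "b\<^sup>2 + Y\<^sup>2 > 0" using pos by (simp add: add_nonneg_pos)
    then show ?thesis
      using pos by (simp add: lorentzian_def field_simps power2_eq_square)
  qed
  show ?thesis
    unfolding 1 2 psd_term_def x_y_X_Y_def(1,2)[symmetric] x_y_X_Y_def(4)[symmetric] 3
    using pos by (simp add: power_divide)
qed

text \<open>
  A majorant has to be decreasing for \<open>dominated_riemann_sums\<close>, but \<open>s powr p\<close> increases when
  \<open>p > 0\<close>. Such an exponent can be lowered to 0, because the bound by \<open>s powr q\<close> already
  takes over for \<open>s \<ge> 1\<close>.
\<close>
lemma le_powr_min_0:
  fixes s p q y :: real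
  assumes "s > 0" "q < 0" "y \<le> s powr p" "y \<le> s powr q"
  shows "y \<le> s powr (min p 0)"
proof (cases "p \<le> 0")
  case False
  have "y \<le> 1"
  proof (cases "s \<le> 1")
    case True
    then have "s powr p \<le> 1 powr p" using False assms(1) by (intro powr_mono2) auto
    then show ?thesis using assms(3) by simp
  next
    case False
    then have "s powr q \<le> 1 powr q" using assms(2) by (intro powr_mono2') auto
    then show ?thesis using assms(4) by simp
  qed
  then show ?thesis using False assms(1) by simp
qed (use assms in auto)

lemma seq_bounded:
  fixes x :: "nat \<Rightarrow> real"
  assumes "x \<longlonglongrightarrow> l"
  obtains M where "M > 0" "\<And>n. \<bar>x n\<bar> \<le> M"
  using convergent_imp_Bseq[of x] assms unfolding convergent_def Bseq_def by auto

lemma floor_index_limits: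
  assumes "t > 0"
  shows "filterlim (\<lambda>N. Suc (nat \<lfloor>t * N\<rfloor>)) at_top at_top"
    and "((\<lambda>N. real (Suc (nat \<lfloor>t * N\<rfloor>)) / N) \<longlongrightarrow> t) at_top"
proof -
  have "filterlim (\<lambda>N. t * N) at_top at_top"
    by (rule filterlim_tendsto_pos_mult_at_top[OF tendsto_const assms filterlim_ident])
  then have "filterlim (\<lambda>N. real (Suc (nat \<lfloor>t * N\<rfloor>))) at_top at_top"
    by (rule filterlim_at_top_mono) (auto intro!: always_eventually, linarith)
  then show "filterlim (\<lambda>N. Suc (nat \<lfloor>t * N\<rfloor>)) at_top at_top"
    using filterlim_sequentially_iff_filterlim_real by blast
  have "((\<lambda>N. t + 1 / N) \<longlongrightarrow> t + 0) at_top"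
    by (intro tendsto_intros tendsto_divide_0[OF tendsto_const] filterlim_at_top_imp_at_infinity
        filterlim_ident)
  then have up: "((\<lambda>N. t + 1 / N) \<longlongrightarrow> t) at_top" by simp
  show "((\<lambda>N. real (Suc (nat \<lfloor>t * N\<rfloor>)) / N) \<longlongrightarrow> t) at_top"
  proof (rule tendsto_sandwich[OF _ _ tendsto_const up])
    show "\<forall>\<^sub>F N in at_top. t \<le> real (Suc (nat \<lfloor>t * N\<rfloor>)) / N"
      using eventually_gt_at_top[of 0]
    proof eventually_elim
      case (elim N)
      have "t * N \<le> real (Suc (nat \<lfloor>t * N\<rfloor>))" by (simp, linarith)
      then show ?case using elim by (simp add: field_simps)
    qed
    show "\<forall>\<^sub>F N in at_top. real (Suc (nat \<lfloor>t * N\<rfloor>)) / N \<le> t + 1 / N"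
      using eventually_gt_at_top[of 0]
    proof eventually_elim
      case (elim N)
      have "0 \<le> t * N" using elim assms by simp
      then have "real (Suc (nat \<lfloor>t * N\<rfloor>)) \<le> t * N + 1" by simp
      then show ?case using elim by (simp add: field_simps)
    qed
  qed
qed

section \<open>The power law\<close>

lemma psd_power_law:
  fixes \<alpha> \<beta> \<omega>\<^sub>0 \<gamma>\<^sub>0 :: real and w \<gamma> :: "nat \<Rightarrow> real"
  assumes \<alpha>: "\<alpha> > \<bar>2 * \<beta> + 1\<bar>"
    and w_pos: "\<And>k. k \<ge> 1 \<Longrightarrow> w k > 0"
    and \<omega>0: "\<omega>\<^sub>0 > 0" and w_lim: "(\<lambda>k. w k / real k powr \<alpha>) \<longlonglongrightarrow> \<omega>\<^sub>0"
    and \<gamma>0: "\<gamma>\<^sub>0 > 0" and \<gamma>_lim: "(\<lambda>k. \<bar>\<gamma> k\<bar> / real k powr \<beta>) \<longlonglongrightarrow> \<gamma>\<^sub>0"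
  shows "summable (psd_term \<gamma> w \<omega>)"
    and "scales_as (psd \<gamma> w) ((2 * \<beta> - \<alpha> + 1) / \<alpha>)"
proof -
  have \<alpha>_pos: "\<alpha> > 0" using \<alpha> by linarith
  define p q where "p = 2 * \<beta> + \<alpha>" and "q = 2 * \<beta> - \<alpha>"
  have p: "p > -1" and q: "q < -1" using \<alpha> by (auto simp: p_def q_def)
  define A B where "A n = \<bar>\<gamma> n\<bar> / real n powr \<beta>" and "B n = w n / real n powr \<alpha>" for n
  have A_lim: "A \<longlonglongrightarrow> \<gamma>\<^sub>0" and B_lim: "B \<longlonglongrightarrow> \<omega>\<^sub>0"
    using \<gamma>_lim w_lim by (simp_all add: A_def [abs_def] B_def [abs_def])
  have B_pos: "B n > 0" if "n \<ge> 1" for n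
    using that w_pos[of n] by (simp add: B_def)
  obtain a where a: "a > 0" "\<And>n. \<bar>(A n)\<^sup>2\<bar> \<le> a"
    using seq_bounded[OF tendsto_power[OF A_lim, of 2]] by blast
  obtain b where b: "b > 0" "\<And>n. \<bar>B n\<bar> \<le> b"
    using seq_bounded[OF B_lim] by blast
  obtain b' where b': "b' > 0" "\<And>n. \<bar>inverse (B n)\<bar> \<le> b'"
    using seq_bounded[OF tendsto_inverse[OF B_lim]] \<omega>0 by auto
  have psd_nonneg: "psd_term \<gamma> w \<omega> k \<ge> 0" for \<omega> k
    using lorentzian_pos[OF w_pos[of "Suc k"], of \<omega>] by (simp add: psd_term_def)

  show summ: "summable (psd_term \<gamma> w \<omega>)" for \<omega>
  proof (rule summable_comparison_test')
    show "summable (\<lambda>k. a * b' * real (Suc k) powr q)"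
      using q summable_real_powr_iff[of q]
      by (intro summable_mult) (subst summable_Suc_iff, simp)
    fix k
    define n where "n = Suc k"
    have n: "n \<ge> 1" "real n > 0" by (simp_all add: n_def)
    have "psd_term \<gamma> w \<omega> k \<le> (\<gamma> n)\<^sup>2 * (1 / w n)"
      unfolding psd_term_def n_def[symmetric]
      by (intro mult_left_mono lorentzian_le_inverse w_pos n) auto
    also have "\<dots> = (A n)\<^sup>2 * inverse (B n) * real n powr q"
      using n by (simp add: A_def B_def q_def powr_diff power_divide field_simps power2_eq_square
          flip: powr_add)
    also have "\<dots> \<le> a * b' * real n powr q"
      using a(2)[of n] b'(2)[of n] B_pos[OF n(1)] a(1) b'(1)
      by (intro mult_right_mono mult_mono) auto
    finally show "norm (psd_term \<gamma> w \<omega> k) \<le> a * b' * real (Suc k) powr q"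
      using psd_nonneg by (simp add: n_def)
  qed

  define F where "F N k = N powr (\<alpha> - 2 * \<beta>) * psd_term \<gamma> w (N powr \<alpha>) k" for N k
  define g where "g t = \<gamma>\<^sub>0\<^sup>2 * (t powr \<beta>)\<^sup>2 * lorentzian (\<omega>\<^sub>0 * t powr \<alpha>) 1" for t
  define K where "K = a * (b + b')"
  define h where "h s = K * min (s powr (min p 0)) (s powr q)" for s
  have K: "K > 0" "a * b \<le> K" "a * b' \<le> K" using a b b' by (simp_all add: K_def)
  have F_eq: "F N k = (A (Suc k))\<^sup>2 * ((real (Suc k) / N) powr \<beta>)\<^sup>2 *
      lorentzian (B (Suc k) * (real (Suc k) / N) powr \<alpha>) 1" if "N > 0" for N k
    unfolding F_def A_def B_def by (rule psd_term_rescale[OF that])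
  have F_nonneg: "F N k \<ge> 0" for N k
    using psd_nonneg by (simp add: F_def)

  have F_bound: "\<bar>F N k\<bar> \<le> h (real (Suc k) / N)" if N: "N > 0" for N k
  proof -
    define n s where "n = Suc k" and "s = real n / N"
    have n: "n \<ge> 1" by (simp add: n_def)
    have s: "s > 0" using N by (simp add: s_def n_def)
    have F: "F N k = (A n)\<^sup>2 * (s powr \<beta>)\<^sup>2 * lorentzian (B n * s powr \<alpha>) 1"
      using F_eq[OF N] by (simp add: s_def n_def)
    have square: "(s powr \<beta>)\<^sup>2 = s powr (2 * \<beta>)"
      by (simp add: power2_eq_square flip: powr_add)
    have Bs: "B n * s powr \<alpha> > 0" using B_pos[OF n] s by simp
    \<comment> \<open>The two estimates of the Lorentzian are sharp for small and for large \<open>s\<close> respectively.\<close>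
    have "F N k \<le> (A n)\<^sup>2 * (s powr \<beta>)\<^sup>2 * (B n * s powr \<alpha>)"
      unfolding F by (intro mult_left_mono lorentzian_1_le Bs) auto
    also have "\<dots> = (A n)\<^sup>2 * B n * s powr p"
      by (simp add: p_def square powr_add)
    also have "\<dots> \<le> a * b * s powr p"
      using a(2)[of n] b(2)[of n] B_pos[OF n] a(1) b(1)
      by (intro mult_right_mono mult_mono) auto
    also have "\<dots> \<le> K * s powr p" using K by (intro mult_right_mono) auto
    finally have 1: "F N k / K \<le> s powr p" using K by (simp add: field_simps)
    have "F N k \<le> (A n)\<^sup>2 * (s powr \<beta>)\<^sup>2 * (1 / (B n * s powr \<alpha>))"
      unfolding F by (intro mult_left_mono lorentzian_le_inverse Bs) auto
    also have "\<dots> = (A n)\<^sup>2 * inverse (B n) * s powr q"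
      using s by (simp add: q_def powr_diff square divide_inverse)
    also have "\<dots> \<le> a * b' * s powr q"
      using a(2)[of n] b'(2)[of n] B_pos[OF n] a(1) b'(1)
      by (intro mult_right_mono mult_mono) auto
    also have "\<dots> \<le> K * s powr q" using K by (intro mult_right_mono) auto
    finally have 2: "F N k / K \<le> s powr q" using K by (simp add: field_simps)
    have "F N k / K \<le> min (s powr (min p 0)) (s powr q)"
      using le_powr_min_0[OF s _ 1 2] q 2 by simp
    then show ?thesis
      using F_nonneg[of N k] unfolding h_def s_def n_def pos_divide_le_eq[OF K(1)]
      by (simp only: abs_of_nonneg mult.commute)
  qed

  have g_lim: "((\<lambda>N. F N (nat \<lfloor>t * N\<rfloor>)) \<longlongrightarrow> g t) at_top" if t: "t > 0" for t
  proof -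
    let ?n = "\<lambda>N. Suc (nat \<lfloor>t * N\<rfloor>)"
    note lims = floor_index_limits[OF t]
    have "((\<lambda>N. A (?n N)) \<longlongrightarrow> \<gamma>\<^sub>0) at_top" "((\<lambda>N. B (?n N)) \<longlongrightarrow> \<omega>\<^sub>0) at_top"
      using filterlim_compose[OF A_lim lims(1)] filterlim_compose[OF B_lim lims(1)] by auto
    then have "((\<lambda>N. (A (?n N))\<^sup>2 * ((real (?n N) / N) powr \<beta>)\<^sup>2 *
        lorentzian (B (?n N) * (real (?n N) / N) powr \<alpha>) 1) \<longlongrightarrow> g t) at_top"
      unfolding g_def lorentzian_def using t
      by (intro tendsto_intros lims(2)) (auto simp: add_nonneg_eq_0_iff)
    then show ?thesis
      by (rule Lim_transform_eventually)
         (use eventually_gt_at_top[of 0] in eventually_elim, simp only: F_eq)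
  qed

  have F_summ: "summable (\<lambda>k. \<bar>F N k\<bar>)" for N
    using summable_mult[OF summ] F_nonneg by (simp add: F_def)
  have g_meas: "g \<in> borel_measurable borel"
    unfolding g_def lorentzian_def by measurable
  have h_anti: "h s \<le> h t" if "0 < t" "t \<le> s" for s t
    unfolding h_def using that K q
    by (intro mult_left_mono min.mono powr_mono2') auto
  have h_int: "set_integrable lborel {0<..} h"
    unfolding h_def using p q by (intro set_integrable_mult_right set_integrable_min_powr) auto
  note riemann = dominated_riemann_sums[OF F_summ g_lim g_meas F_bound h_anti h_int]
  define C where "C = (LINT t:{0<..}|lborel. g t)"
  have C: "C > 0"
    unfolding C_def
    by (rule set_integral_pos[OF riemann(2)])
       (use \<gamma>0 \<omega>0 in \<open>auto simp: g_def intro!: mult_pos_pos lorentzian_pos\<close>)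
  have lim: "((\<lambda>N. (\<Sum>k. F N k) / N) \<longlongrightarrow> C) at_top"
    using riemann(1) by (simp add: C_def)
  have sub: "filterlim (\<lambda>\<omega>::real. \<omega> powr (1 / \<alpha>)) at_top at_top"
    using \<alpha>_pos by (intro real_powr_at_top) auto
  have "((\<lambda>\<omega>. psd \<gamma> w \<omega> / \<omega> powr ((2 * \<beta> - \<alpha> + 1) / \<alpha>)) \<longlongrightarrow> C) at_top"
  proof (rule Lim_transform_eventually[OF filterlim_compose[OF lim sub]])
    show "\<forall>\<^sub>F \<omega> in at_top. (\<Sum>k. F (\<omega> powr (1 / \<alpha>)) k) / \<omega> powr (1 / \<alpha>) =
        psd \<gamma> w \<omega> / \<omega> powr ((2 * \<beta> - \<alpha> + 1) / \<alpha>)"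
      using eventually_gt_at_top[of 0]
    proof eventually_elim
      case (elim \<omega>)
      define N where "N = \<omega> powr (1 / \<alpha>)"
      have N: "N > 0" "N powr \<alpha> = \<omega>" using elim \<alpha>_pos by (simp_all add: N_def powr_powr)
      have "(\<Sum>k. F N k) / N = N powr (\<alpha> - 2 * \<beta>) / N * psd \<gamma> w \<omega>"
        using suminf_mult[OF summ] by (simp add: F_def N psd_def)
      also have "N powr (\<alpha> - 2 * \<beta>) / N = 1 / N powr (2 * \<beta> - \<alpha> + 1)"
        using N(1) by (simp add: powr_diff powr_add field_simps)
      also have "N powr (2 * \<beta> - \<alpha> + 1) = \<omega> powr ((2 * \<beta> - \<alpha> + 1) / \<alpha>)"
        by (simp add: N_def powr_powr)
      finally show ?case by (simp add: N_def)
    qed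
  qed
  then show "scales_as (psd \<gamma> w) ((2 * \<beta> - \<alpha> + 1) / \<alpha>)"
    using C unfolding scales_as_def by blast
qed

theorem mainTheorem2:
  fixes \<alpha> \<beta> \<omega>\<^sub>0 \<gamma>\<^sub>0 \<zeta> :: real and w \<gamma> :: "nat \<Rightarrow> real"
  assumes "\<alpha> > 0"
    and "\<And>k. k \<ge> 1 \<Longrightarrow> w k > 0"
    and "\<omega>\<^sub>0 > 0" and "(\<lambda>k. w k / real k powr \<alpha>) \<longlonglongrightarrow> \<omega>\<^sub>0"
    and "\<gamma>\<^sub>0 > 0" and "(\<lambda>k. \<bar>\<gamma> k\<bar> / real k powr \<beta>) \<longlonglongrightarrow> \<gamma>\<^sub>0"
    and "\<zeta> = (2 * \<beta> - \<alpha> + 1) / \<alpha>"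
  shows "(\<alpha> > \<bar>2 * \<beta> + 1\<bar> \<longrightarrow>
            (\<forall>\<omega>. summable (psd_term \<gamma> w \<omega>)) \<and>
            scales_as (psd \<gamma> w) \<zeta> \<and> -2 < \<zeta> \<and> \<zeta> < 0) \<and>
         (\<beta> = -1/2 \<longrightarrow> \<zeta> = -1 \<and> scales_as (psd \<gamma> w) (-1))"
proof -
  note law = psd_power_law[OF _ assms(2-6)]
  have exponent: "-2 < \<zeta> \<and> \<zeta> < 0" if "\<alpha> > \<bar>2 * \<beta> + 1\<bar>"
    using that \<open>\<alpha> > 0\<close> unfolding assms(7) by (simp add: field_simps) linarith
  have noise: "\<zeta> = -1" if "\<beta> = -1/2"
    using that \<open>\<alpha> > 0\<close> unfolding assms(7) by simp
  have "scales_as (psd \<gamma> w) (-1)" if "\<beta> = -1/2"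
    using law(2) noise[OF that] that \<open>\<alpha> > 0\<close> assms(7) by simp
  then show ?thesis
    using law exponent noise assms(7) by auto
qed

end
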